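(* Let $X$ be any topological space and $\kappa$ any infinite cardinal. Then the following are equivalent: (a) $\mathcal F(X)\le\kappa$; (b) for every $Y\subseteq X$, every family $\mathcal U$ of nonempty open subsets of $X$ such that for each $A\subseteq Y$ with $|A|\le\kappa$ there is $U\in\mathcal U$ with $\overline A\subseteq U$, has a subfamily $\mathcal V\subseteq\mathcal U$ with $|\mathcal V|\le\kappa$ covering $Y$.
   Context: Closures are taken in $X$. A sequence $P=\{p_\alpha:\alpha<\mu\}\subseteq X$ indexed by an ordinal $\mu$ is a free sequence in $X$ if $\overline{\{p_\alpha:\alpha<\delta\}}\cap\overline{\{p_\alpha:\delta\le\alpha<\mu\}}=\emptyset$ for every $\delta<\mu$. $\mathcal F(X)=\sup\{|P|:P\text{ is a free sequence in }X\}$. *)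

theory Defs
  imports "HOL-Analysis.Abstract_Topology"
begin

unbundle cardinal_syntax

(* Supremum of the cardinals |A|, A in AA.  As in HOL.BNF_Cardinal_Order_Relation, a cardinal
   is a well-order relation satisfying Card_order, so the supremum is determined only up to
   order isomorphism (=o).  The bound |UNIV| makes it exist as a relation on the same type;
   card_Sup_least shows that it is also least among upper bounds on all other types. *)
definition card_Sup :: "'a set set \<Rightarrow> 'a rel" where
  "card_Sup \<A> = (SOME c. Card_order c \<and> (\<forall>A\<in>\<A>. |A| \<le>o c) \<and>
      (\<forall>d :: 'a rel. Card_order d \<and> (\<forall>A\<in>\<A>. |A| \<le>o d) \<longrightarrow> c \<le>o d))"

(* The ordinal mu is represented by a (reflexive) well-order r, its elements by Field r;
   underS r d and above r d stand for {alpha. alpha < delta} and {alpha. delta <= alpha < mu}. *)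
definition free_sequence :: "'a topology \<Rightarrow> 'i rel \<Rightarrow> ('i \<Rightarrow> 'a) \<Rightarrow> bool" where
  "free_sequence X r p \<longleftrightarrow>
     Well_order r \<and> p ` Field r \<subseteq> topspace X \<and>
     (\<forall>d\<in>Field r. X closure_of (p ` underS r d) \<inter> X closure_of (p ` above r d) = {})"

(* The index orders may be taken on the point type 'a: terms of a free sequence are distinct,
   so a free sequence over any index type can be indexed by its own range
   (free_sequence_reindex). *)
definition free_sequence_number :: "'a topology \<Rightarrow> 'a rel" ("\<F>") where
  "\<F> X = card_Sup {P. \<exists>(r :: 'a rel) p. free_sequence X r p \<and> P = p ` Field r}"

lemma card_Sup_props:
  fixes \<A> :: "'a set set"
  shows "Card_order (card_Sup \<A>) \<and> (\<forall>A\<in>\<A>. |A| \<le>o card_Sup \<A>) \<and>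
      (\<forall>d :: 'a rel. Card_order d \<and> (\<forall>A\<in>\<A>. |A| \<le>o d) \<longrightarrow> card_Sup \<A> \<le>o d)"
proof -
  let ?R = "{c :: 'a rel. Card_order c \<and> (\<forall>A\<in>\<A>. |A| \<le>o c)}"
  have "|UNIV :: 'a set| \<in> ?R"
    by (auto simp: card_of_Card_order intro: card_of_mono1)
  then obtain c where "c \<in> ?R" "\<forall>d\<in>?R. c \<le>o d"
    using exists_minim_Card_order[of ?R] by blast
  then have "Card_order c \<and> (\<forall>A\<in>\<A>. |A| \<le>o c) \<and>
      (\<forall>d :: 'a rel. Card_order d \<and> (\<forall>A\<in>\<A>. |A| \<le>o d) \<longrightarrow> c \<le>o d)"
    by blast
  then show ?thesis
    unfolding card_Sup_def by (rule someI)
qed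

lemma card_Sup_Card_order: "Card_order (card_Sup \<A>)"
  using card_Sup_props by blast

lemma card_Sup_upper: "A \<in> \<A> \<Longrightarrow> |A| \<le>o card_Sup \<A>"
  using card_Sup_props by blast

lemma card_Sup_least:
  fixes \<A> :: "'a set set" and d :: "'b rel"
  assumes d: "Card_order d" and ub: "\<And>A. A \<in> \<A> \<Longrightarrow> |A| \<le>o d"
  shows "card_Sup \<A> \<le>o d"
proof -
  have wd: "Well_order d"
    using d by (simp add: card_order_on_def)
  consider "|UNIV :: 'a set| \<le>o d" | "d \<le>o |UNIV :: 'a set|"
    using ordLeq_total[OF wd card_of_Well_order] by blast
  then show ?thesis
  proof cases
    case 1
    have "card_Sup \<A> \<le>o |UNIV :: 'a set|"
      using card_Sup_props[of \<A>] card_of_Card_order card_of_mono1[OF subset_UNIV] by blast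
    then show ?thesis
      using 1 ordLeq_transitive by blast
  next
    case 2
    then obtain e :: "'a rel" where e: "d =o e"
      using internalize_ordLeq[of d "|UNIV :: 'a set|"] by blast
    have "Card_order e"
      using Card_order_ordIso2[OF d e] .
    moreover have "|A| \<le>o e" if "A \<in> \<A>" for A
      using ordLeq_ordIso_trans[OF ub[OF that] e] .
    ultimately have "card_Sup \<A> \<le>o e"
      using card_Sup_props[of \<A>] by blast
    then show ?thesis
      using e ordIso_symmetric ordLeq_ordIso_trans by blast
  qed
qed

lemma free_sequence_inj_on:
  assumes "free_sequence X r p"
  shows "inj_on p (Field r)"
proof -
  have wo: "Well_order r" and sub: "p ` Field r \<subseteq> topspace X"
    and dj: "\<And>d. d \<in> Field r \<Longrightarrow>
      X closure_of (p ` underS r d) \<inter> X closure_of (p ` above r d) = {}"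
    using assms by (auto simp: free_sequence_def)
  have refl: "\<And>x. x \<in> Field r \<Longrightarrow> (x, x) \<in> r"
    using wo by (auto simp: order_on_defs refl_on_def)
  have neq: "p a \<noteq> p b" if "(a, b) \<in> r" "a \<noteq> b" for a b
  proof
    assume eq: "p a = p b"
    have F: "a \<in> Field r" "b \<in> Field r"
      using that by (auto simp: Field_def)
    have "p ` underS r b \<subseteq> topspace X" "p ` above r b \<subseteq> topspace X"
      using sub by (auto simp: underS_def above_def Field_def)
    then have "p ` underS r b \<subseteq> X closure_of (p ` underS r b)"
      "p ` above r b \<subseteq> X closure_of (p ` above r b)"
      by (auto intro!: closure_of_subset)
    moreover have "p a \<in> p ` underS r b" "p b \<in> p ` above r b"
      using that refl F by (auto simp: underS_def above_def)
    ultimately show False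
      using dj[OF F(2)] eq by auto
  qed
  have tot: "(a, b) \<in> r \<or> (b, a) \<in> r" if "a \<in> Field r" "b \<in> Field r" "a \<noteq> b" for a b
    using wo that by (auto simp: order_on_defs total_on_def)
  show ?thesis
    by (rule inj_onI) (metis neq tot)
qed

lemma free_sequence_reindex:
  fixes X :: "'a topology" and r :: "'i rel"
  assumes "free_sequence X r p"
  shows "\<exists>s :: 'a rel. free_sequence X s id \<and> r =o s \<and> Field s = p ` Field r"
proof -
  let ?s = "dir_image r p"
  have inj: "inj_on p (Field r)"
    using free_sequence_inj_on[OF assms] .
  have wo: "Well_order r" and sub: "p ` Field r \<subseteq> topspace X"
    and dj: "\<And>d. d \<in> Field r \<Longrightarrow>
      X closure_of (p ` underS r d) \<inter> X closure_of (p ` above r d) = {}"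
    using assms by (auto simp: free_sequence_def)
  have F: "Field ?s = p ` Field r"
    by (rule dir_image_Field)
  have rF: "(a, b) \<in> r \<Longrightarrow> a \<in> Field r \<and> b \<in> Field r" for a b
    by (auto simp: Field_def)
  have pair: "(p a, p b) \<in> ?s \<longleftrightarrow> (a, b) \<in> r" if "a \<in> Field r" "b \<in> Field r" for a b
  proof
    assume "(p a, p b) \<in> ?s"
    then obtain a' b' where "p a = p a'" "p b = p b'" "(a', b') \<in> r"
      unfolding dir_image_def by blast
    then show "(a, b) \<in> r"
      using inj_onD[OF inj] rF that by metis
  qed (auto simp: dir_image_def)
  have sF: "(u, v) \<in> ?s \<Longrightarrow> u \<in> p ` Field r \<and> v \<in> p ` Field r" for u v
    by (auto simp: dir_image_def Field_def)
  have "underS ?s (p d) = p ` underS r d" if d: "d \<in> Field r" for d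
  proof (intro set_eqI iffI)
    fix u assume "u \<in> underS ?s (p d)"
    then have u: "u \<noteq> p d" "(u, p d) \<in> ?s" by (auto simp: underS_def)
    then obtain a where "a \<in> Field r" "u = p a" using sF by blast
    then show "u \<in> p ` underS r d"
      using u pair[of a d] d by (auto simp: underS_def)
  next
    fix u assume "u \<in> p ` underS r d"
    then obtain a where a: "u = p a" "a \<noteq> d" "(a, d) \<in> r" by (auto simp: underS_def)
    then have "a \<in> Field r" using rF by blast
    then show "u \<in> underS ?s (p d)"
      using a pair[of a d] d inj by (auto simp: underS_def dest: inj_onD)
  qed
  moreover have "above ?s (p d) = p ` above r d" if d: "d \<in> Field r" for d
  proof (intro set_eqI iffI)
    fix u assume "u \<in> above ?s (p d)"
    then have u: "(p d, u) \<in> ?s" by (auto simp: above_def)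
    then obtain a where "a \<in> Field r" "u = p a" using sF by blast
    then show "u \<in> p ` above r d"
      using u pair[of d a] d by (auto simp: above_def)
  next
    fix u assume "u \<in> p ` above r d"
    then obtain a where a: "u = p a" "(d, a) \<in> r" by (auto simp: above_def)
    then show "u \<in> above ?s (p d)"
      using pair[of d a] d rF by (auto simp: above_def)
  qed
  ultimately have "free_sequence X ?s id"
    using Well_order_dir_image[OF wo inj] sub dj
    unfolding free_sequence_def F by auto
  then show ?thesis
    using dir_image_ordIso[OF wo inj] F by blast
qed

lemma free_sequence_number_upper:
  assumes "free_sequence X r p"
  shows "|p ` Field r| \<le>o \<F> X"
proof -
  obtain s where "free_sequence X s id" "Field s = p ` Field r"
    using free_sequence_reindex[OF assms] by blast
  then have "p ` Field r \<in> {P. \<exists>(r :: 'a rel) p. free_sequence X r p \<and> P = p ` Field r}"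
    by (auto intro!: exI[of _ s] exI[of _ id])
  then show ?thesis
    unfolding free_sequence_number_def by (rule card_Sup_upper)
qed

end

(* Both directions reduce to free sequences of length kappa^+.  If Y had no subfamily of size at
   most kappa covering it, choose recursively U_alpha in the family containing the closure of
   {p_beta : beta < alpha} and p_alpha in Y outside all U_beta, beta <= alpha; the open set U_alpha
   then separates the initial segment from the tail.  Conversely, for a free sequence p of length
   kappa^+ the complements of the closures of its tails form a family on Y = range p violating (b),
   because kappa^+ is regular. *)
theory Submission
  imports Defs
begin

section \<open>Reduction to length kappa^+, and regularity of kappa^+\<close>

text \<open>Cuts a long free sequence down to a prescribed shorter length. The map \<open>f\<close>
  sends each initial segment and each tail of \<open>s\<close> into the corresponding one of
  \<open>r\<close>, and closure is monotone, so disjointness is inherited.\<close>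

lemma free_sequence_embed:
  assumes q: "free_sequence X r p" and s: "Well_order s" and f: "embed s r f"
  shows "free_sequence X s (p \<circ> f)"
proof -
  have r: "Well_order r" and sub: "p ` Field r \<subseteq> topspace X"
    and dj: "\<And>d. d \<in> Field r \<Longrightarrow>
      X closure_of (p ` underS r d) \<inter> X closure_of (p ` above r d) = {}"
    using q by (auto simp: free_sequence_def)
  have fF: "f ` Field s \<subseteq> Field r"
    by (rule embed_Field[OF f])
  have comp: "compat s r f"
    using embed_compat[OF f] .
  have inj: "inj_on f (Field s)"
    using embed_inj_on[OF s f] .
  have below: "f ` underS s d \<subseteq> underS r (f d)" if "d \<in> Field s" for d
    using comp inj that by (auto simp: underS_def compat_def intro: FieldI1 dest: inj_onD)
  have above: "f ` above s d \<subseteq> above r (f d)" for d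
    using comp by (auto simp: above_def compat_def)
  have "X closure_of ((p \<circ> f) ` underS s d) \<inter> X closure_of ((p \<circ> f) ` above s d) = {}"
    if d: "d \<in> Field s" for d
  proof -
    have "X closure_of ((p \<circ> f) ` underS s d) \<subseteq> X closure_of (p ` underS r (f d))"
      unfolding image_comp[symmetric] by (intro closure_of_mono image_mono below d)
    moreover have "X closure_of ((p \<circ> f) ` above s d) \<subseteq> X closure_of (p ` above r (f d))"
      unfolding image_comp[symmetric] by (intro closure_of_mono image_mono above)
    ultimately show ?thesis
      using dj[of "f d"] d fF by blast
  qed
  moreover have "(p \<circ> f) ` Field s \<subseteq> topspace X"
    using sub fF by fastforce
  ultimately show ?thesis
    using s by (simp add: free_sequence_def)
qed

text \<open>Trades the supremum for one fixed length. Terms of a free sequence are distinct, so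
  length kappa^+ forces a range of size kappa^+. Conversely, a range larger than kappa makes the
  index order long enough for \<open>cardSuc \<kappa>\<close> to embed into it.\<close>

lemma free_sequence_number_ordLeq_iff:
  fixes X :: "'a topology" and \<kappa> :: "'k rel"
  assumes \<kappa>: "Card_order \<kappa>"
  shows "\<F> X \<le>o \<kappa> \<longleftrightarrow> (\<nexists>p. free_sequence X (cardSuc \<kappa>) p)"
proof
  assume le: "\<F> X \<le>o \<kappa>"
  show "\<nexists>p. free_sequence X (cardSuc \<kappa>) p"
  proof
    assume "\<exists>p. free_sequence X (cardSuc \<kappa>) p"
    then obtain p where p: "free_sequence X (cardSuc \<kappa>) p" ..
    have "cardSuc \<kappa> =o |Field (cardSuc \<kappa>)|"
      using card_of_Field_ordIso[OF cardSuc_Card_order[OF \<kappa>]] ordIso_symmetric by blast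
    also have "|Field (cardSuc \<kappa>)| =o |p ` Field (cardSuc \<kappa>)|"
      using free_sequence_inj_on[OF p] card_of_ordIso
      by (metis bij_betw_imageI)
    also have "|p ` Field (cardSuc \<kappa>)| \<le>o \<F> X"
      by (rule free_sequence_number_upper[OF p])
    also note le
    finally show False
      using cardSuc_greater[OF \<kappa>] not_ordLess_ordLeq by blast
  qed
next
  assume no: "\<nexists>p. free_sequence X (cardSuc \<kappa>) p"
  have "|p ` Field r| \<le>o \<kappa>" if p: "free_sequence X r p" for r :: "'a rel" and p
  proof (rule ccontr)
    have r: "Well_order r"
      using p by (simp add: free_sequence_def)
    assume "\<not> |p ` Field r| \<le>o \<kappa>"
    then have "\<kappa> <o |p ` Field r|"
      using \<kappa> card_of_Well_order not_ordLeq_iff_ordLess by (metis card_order_on_def)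
    then have "cardSuc \<kappa> \<le>o |p ` Field r|"
      using cardSuc_ordLess_ordLeq[OF \<kappa> card_of_Card_order] by blast
    also have "|p ` Field r| \<le>o |Field r|"
      by (rule card_of_image)
    \<comment> \<open>The order \<open>r\<close> may be any well-order, not just a cardinal; a
      cardinal is the least well-order on its set, so \<open>r\<close> is at least as long.\<close>
    also have "|Field r| \<le>o r"
      by (rule card_of_least[OF r])
    finally obtain f where "Well_order (cardSuc \<kappa>)" "embed (cardSuc \<kappa>) r f"
      unfolding ordLeq_def by blast
    then show False
      using free_sequence_embed[OF p] no by blast
  qed
  then show "\<F> X \<le>o \<kappa>"
    unfolding free_sequence_number_def by (intro card_Sup_least \<kappa>) blast
qed

text \<open>Regularity of kappa^+: a set of size at most kappa inside the union of a kappa^+-chain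
  lies in one member of the chain. The chain here consists of the initial segments, which exhaust
  the field because an infinite cardinal has no last element.\<close>

lemma cardSuc_bounded:
  assumes \<kappa>: "Cinfinite \<kappa>" and B: "B \<subseteq> Field (cardSuc \<kappa>)" "|B| \<le>o \<kappa>"
  shows "\<exists>d\<in>Field (cardSuc \<kappa>). B \<subseteq> underS (cardSuc \<kappa>) d"
proof (rule cardSuc_UNION)
  show C: "Card_order \<kappa>" and inf: "infinite (Field \<kappa>)"
    using \<kappa> by (auto simp: cinfinite_def)
  have S: "Card_order (cardSuc \<kappa>)"
    by (rule cardSuc_Card_order[OF C])
  then have "wo_rel (cardSuc \<kappa>)"
    by (simp add: wo_rel_def card_order_on_def)
  then have "trans (cardSuc \<kappa>)" "antisym (cardSuc \<kappa>)"
    using wo_rel.TRANS wo_rel.ANTISYM by blast+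
  then show "relChain (cardSuc \<kappa>) (underS (cardSuc \<kappa>))"
    unfolding relChain_def using underS_incr by metis
  have "infinite (Field (cardSuc \<kappa>))"
    using cardSuc_finite[OF C] inf by blast
  then show "B \<subseteq> (\<Union>i\<in>Field (cardSuc \<kappa>). underS (cardSuc \<kappa>) i)"
    using infinite_Card_order_limit[OF S] B(1) by (fastforce simp: underS_def)
  show "|B| \<le>o \<kappa>"
    by fact
qed

section \<open>From a failure of (b) to a free sequence\<close>

lemma free_sequence_of_no_small_cover:
  fixes X :: "'a topology" and \<kappa> :: "'k rel"
  assumes \<kappa>: "Cinfinite \<kappa>" and Y: "Y \<subseteq> topspace X"
    and op: "\<And>U. U \<in> \<U> \<Longrightarrow> openin X U"
    and small: "\<And>A. A \<subseteq> Y \<Longrightarrow> |A| \<le>o \<kappa> \<Longrightarrow> \<exists>U\<in>\<U>. X closure_of A \<subseteq> U"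
    and nocover: "\<And>\<V>. \<V> \<subseteq> \<U> \<Longrightarrow> |\<V>| \<le>o \<kappa> \<Longrightarrow> \<not> Y \<subseteq> \<Union>\<V>"
  shows "\<exists>p. free_sequence X (cardSuc \<kappa>) p"
proof -
  let ?r = "cardSuc \<kappa>"
  have C: "Card_order \<kappa>"
    using \<kappa> by blast
  have r: "Card_order ?r"
    by (rule cardSuc_Card_order[OF C])
  then have WO: "Well_order ?r"
    by (simp add: card_order_on_def)
  then interpret wo: wo_rel ?r
    by (simp add: wo_rel_def)
  have leq: "|underS ?r d| \<le>o \<kappa>" if "d \<in> Field ?r" for d
    using card_of_underS[OF r that] cardSuc_ordLeq_ordLess[OF C card_of_Card_order] by blast
  \<comment> \<open>Closed segments are also small: a later index \<open>e\<close> exists, and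
    \<open>under ?r d\<close> sits inside \<open>underS ?r e\<close>.\<close>
  have leq': "|under ?r d| \<le>o \<kappa>" if d: "d \<in> Field ?r" for d
  proof -
    have "infinite (Field ?r)"
      using cardSuc_finite[OF C] \<kappa> by (simp add: cinfinite_def)
    then obtain e where e: "e \<in> Field ?r" "d \<noteq> e" "(d, e) \<in> ?r"
      using infinite_Card_order_limit[OF r _ d] by blast
    then have "under ?r d \<subseteq> underS ?r e"
      using wo.TRANS wo.ANTISYM by (auto simp: under_def underS_def dest: transD antisymD)
    then show ?thesis
      using leq[OF e(1)] card_of_mono1 ordLeq_transitive by blast
  qed
  \<comment> \<open>Intersecting with \<open>Y\<close> makes the choice meaningful for every small
    \<open>A\<close>, so \<open>U_in\<close> and \<open>U_cl\<close> can be proved before the values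
    of \<open>p\<close> are known to lie in \<open>Y\<close>.\<close>
  define G where "G A = (SOME U. U \<in> \<U> \<and> X closure_of (A \<inter> Y) \<subseteq> U)" for A
  have G: "G A \<in> \<U>" "X closure_of (A \<inter> Y) \<subseteq> G A" if A: "|A| \<le>o \<kappa>" for A
  proof -
    have "|A \<inter> Y| \<le>o \<kappa>"
      using A card_of_mono1[of "A \<inter> Y" A] ordLeq_transitive by blast
    then have "\<exists>U. U \<in> \<U> \<and> X closure_of (A \<inter> Y) \<subseteq> U"
      using small[of "A \<inter> Y"] by blast
    then show "G A \<in> \<U>" "X closure_of (A \<inter> Y) \<subseteq> G A"
      unfolding G_def by (metis (mono_tags, lifting) someI_ex)+
  qed
  \<comment> \<open>The union includes b = d, so the new point also avoids its own open set. This is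
    not circular: that set depends only on the values of \<open>p\<close> strictly before
    \<open>d\<close>, which is what admissibility of \<open>H\<close> checks.\<close>
  define H where
    "H p d = (SOME y. y \<in> Y \<and> y \<notin> (\<Union>b\<in>under ?r d. G (p ` underS ?r b)))" for p d
  define p where "p = wo.worec H"
  define U where "U d = G (p ` underS ?r d)" for d
  have "wo.adm_wo H"
    unfolding wo.adm_wo_def
  proof (intro allI impI)
    fix f g :: "'k set \<Rightarrow> 'a" and d
    assume eq: "\<forall>y\<in>underS ?r d. f y = g y"
    have "underS ?r b \<subseteq> underS ?r d" if "b \<in> under ?r d" for b
      using that underS_incr[OF wo.TRANS wo.ANTISYM, of b d] by (simp add: under_def)
    then have "f ` underS ?r b = g ` underS ?r b" if "b \<in> under ?r d" for b
      using that eq by (intro image_cong) auto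
    then show "H f d = H g d"
      by (simp add: H_def cong: SUP_cong)
  qed
  then have rec: "p = H p"
    unfolding p_def by (rule wo.worec_fixpoint)
  have U_in: "U d \<in> \<U>" and U_cl: "X closure_of ((p ` underS ?r d) \<inter> Y) \<subseteq> U d"
    if "d \<in> Field ?r" for d
    using G[OF ordLeq_transitive[OF card_of_image leq[OF that]]] by (simp_all add: U_def)
  have p: "p d \<in> Y \<and> p d \<notin> (\<Union>b\<in>under ?r d. U b)" if d: "d \<in> Field ?r" for d
  proof -
    have "U ` under ?r d \<subseteq> \<U>"
      using U_in under_Field[of ?r d] by blast
    moreover have "|U ` under ?r d| \<le>o \<kappa>"
      using card_of_image leq'[OF d] ordLeq_transitive by blast
    ultimately have "\<not> Y \<subseteq> \<Union>(U ` under ?r d)"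
      by (rule nocover)
    then have "\<exists>y. y \<in> Y \<and> y \<notin> (\<Union>b\<in>under ?r d. U b)"
      by blast
    then have "H p d \<in> Y \<and> H p d \<notin> (\<Union>b\<in>under ?r d. U b)"
      unfolding H_def U_def by (rule someI_ex)
    then show ?thesis
      unfolding fun_cong[OF rec, of d, symmetric] .
  qed
  have "X closure_of (p ` underS ?r d) \<inter> X closure_of (p ` above ?r d) = {}"
    if d: "d \<in> Field ?r" for d
  proof -
    have "p ` underS ?r d \<subseteq> Y"
      using p Order_Relation.underS_Field[of ?r d] by blast
    then have below: "X closure_of (p ` underS ?r d) \<subseteq> U d"
      using U_cl[OF d] by (simp add: Int_absorb2)
    \<comment> \<open>If e lies in \<open>above ?r d\<close>, then d lies in
      \<open>under ?r e\<close>, so \<open>p e\<close> was chosen outside \<open>U d\<close>.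
      Openness of \<open>U d\<close> then extends the disjointness to the closure of the
      tail.\<close>
    have "U d \<inter> p ` above ?r d = {}"
      using p by (fastforce simp: above_def under_def Field_def)
    then have "U d \<inter> X closure_of (p ` above ?r d) = {}"
      using openin_Int_closure_of_eq_empty op[OF U_in[OF d]] by metis
    then show ?thesis
      using below by blast
  qed
  then have "free_sequence X ?r p"
    using WO p Y by (auto simp: free_sequence_def)
  then show ?thesis
    by blast
qed

section \<open>From a free sequence to a failure of (b)\<close>

text \<open>The set \<open>W d\<close> contains the closure of the points before \<open>d\<close>
  and misses every point from \<open>d\<close> on. Regularity is used twice: it bounds the indices
  of a small set of points, giving one \<open>W d\<close> around its closure, and the indices of a
  small subfamily, giving a point that the subfamily misses.\<close>

lemma free_sequence_no_small_cover:
  fixes X :: "'a topology" and \<kappa> :: "'k rel"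
  assumes \<kappa>: "Cinfinite \<kappa>" and p: "free_sequence X (cardSuc \<kappa>) p"
  obtains Y \<U> where "Y \<subseteq> topspace X" "\<And>U. U \<in> \<U> \<Longrightarrow> openin X U \<and> U \<noteq> {}"
    "\<And>A. A \<subseteq> Y \<Longrightarrow> |A| \<le>o \<kappa> \<Longrightarrow> \<exists>U\<in>\<U>. X closure_of A \<subseteq> U"
    "\<And>\<V>. \<V> \<subseteq> \<U> \<Longrightarrow> |\<V>| \<le>o \<kappa> \<Longrightarrow> \<not> Y \<subseteq> \<Union>\<V>"
proof -
  let ?r = "cardSuc \<kappa>"
  have sub: "p ` Field ?r \<subseteq> topspace X"
    and dj: "\<And>d. d \<in> Field ?r \<Longrightarrow>
      X closure_of (p ` underS ?r d) \<inter> X closure_of (p ` above ?r d) = {}"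
    using p by (auto simp: free_sequence_def)
  have C: "Card_order \<kappa>" and inf: "infinite (Field \<kappa>)"
    using \<kappa> by (auto simp: cinfinite_def)
  define W where "W d = topspace X - X closure_of (p ` above ?r d)" for d
  define \<U> where "\<U> = {W d |d. d \<in> Field ?r \<and> W d \<noteq> {}}"
  have W_below: "X closure_of (p ` underS ?r d) \<subseteq> W d" if "d \<in> Field ?r" for d
    using dj[OF that] closure_of_subset_topspace[of X "p ` underS ?r d"] unfolding W_def by blast
  \<comment> \<open>Picking one index per element keeps the index set small even where
    \<open>f\<close> is not injective. It is applied to \<open>p\<close> and then to
    \<open>W\<close>.\<close>
  have pull: "\<exists>B\<subseteq>Field ?r. f ` B = A \<and> |B| \<le>o \<kappa>"
    if A: "A \<subseteq> f ` Field ?r" "|A| \<le>o \<kappa>" for f :: "'k set \<Rightarrow> 'b" and A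
  proof -
    obtain B where B: "B \<subseteq> Field ?r" "inj_on f B" "A = f ` B"
      using A(1) by (auto simp: subset_image_inj)
    then have "|B| =o |A|"
      using card_of_ordIso by (metis bij_betw_imageI)
    then show ?thesis
      using A(2) B ordIso_ordLeq_trans by blast
  qed
  show thesis
  proof (rule that[of "p ` Field ?r" \<U>])
    show "p ` Field ?r \<subseteq> topspace X"
      by fact
    show "openin X U \<and> U \<noteq> {}" if "U \<in> \<U>" for U
      using that by (auto simp: \<U>_def W_def)
  next
    fix A assume "A \<subseteq> p ` Field ?r" "|A| \<le>o \<kappa>"
    then obtain B where B: "B \<subseteq> Field ?r" "p ` B = A" "|B| \<le>o \<kappa>"
      using pull by blast
    have "infinite (Field ?r)"
      using cardSuc_finite[OF C] inf by blast
    then obtain a where a: "a \<in> Field ?r"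
      using infinite_imp_nonempty by blast
    (* The extra index a keeps W d nonempty when A is empty. *)
    have "|{a}| \<le>o \<kappa>"
      using C inf card_of_Well_order
      by (intro ordLess_imp_ordLeq finite_ordLess_infinite)
        (auto simp: card_order_on_def Field_card_of)
    then have "|{a} \<union> B| \<le>o \<kappa>"
      by (rule card_of_Un_ordLeq_infinite_Field[OF inf _ B(3) C])
    then obtain d where d: "d \<in> Field ?r" "{a} \<union> B \<subseteq> underS ?r d"
      using cardSuc_bounded[OF \<kappa>, of "{a} \<union> B"] a B(1) by blast
    have "X closure_of A \<subseteq> X closure_of (p ` underS ?r d)"
      using B(2) d(2) by (intro closure_of_mono) auto
    then have "X closure_of A \<subseteq> W d"
      using W_below[OF d(1)] by blast
    moreover have "p a \<in> X closure_of (p ` underS ?r d)"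
      using d(2) sub Order_Relation.underS_Field[of ?r d] closure_of_subset[of "p ` underS ?r d" X]
      by blast
    then have "W d \<noteq> {}"
      using W_below[OF d(1)] by blast
    ultimately show "\<exists>U\<in>\<U>. X closure_of A \<subseteq> U"
      using d(1) by (auto simp: \<U>_def)
  next
    fix \<V> assume \<V>: "\<V> \<subseteq> \<U>" "|\<V>| \<le>o \<kappa>"
    then have "\<V> \<subseteq> W ` Field ?r"
      by (auto simp: \<U>_def)
    then obtain D where D: "D \<subseteq> Field ?r" "W ` D = \<V>" "|D| \<le>o \<kappa>"
      using pull[OF _ \<V>(2)] by metis
    then obtain e where e: "e \<in> Field ?r" "D \<subseteq> underS ?r e"
      using cardSuc_bounded[OF \<kappa>] by blast
    \<comment> \<open>Since \<open>e\<close> lies beyond all of \<open>D\<close>, the point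
      \<open>p e\<close> belongs to the tail at each \<open>d\<close> in \<open>D\<close>, whose
      closure \<open>W d\<close> omits.\<close>
    have "p e \<notin> W d" if "d \<in> D" for d
    proof -
      have "p e \<in> p ` above ?r d"
        using that e(2) by (auto simp: above_def underS_def)
      moreover have "p ` above ?r d \<subseteq> topspace X"
        using sub by (auto simp: above_def Field_def)
      ultimately show ?thesis
        using closure_of_subset[of "p ` above ?r d" X] unfolding W_def by blast
    qed
    then show "\<not> p ` Field ?r \<subseteq> \<Union>\<V>"
      using D(2) e(1) by blast
  qed
qed

theorem lemma2p4:
  fixes X :: "'a topology" and \<kappa> :: "'k rel"
  assumes "Cinfinite \<kappa>"
  shows "\<F> X \<le>o \<kappa> \<longleftrightarrow>
    (\<forall>Y \<U>. Y \<subseteq> topspace X \<longrightarrow>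
       (\<forall>U\<in>\<U>. openin X U \<and> U \<noteq> {}) \<longrightarrow>
       (\<forall>A. A \<subseteq> Y \<longrightarrow> |A| \<le>o \<kappa> \<longrightarrow> (\<exists>U\<in>\<U>. X closure_of A \<subseteq> U)) \<longrightarrow>
       (\<exists>\<V>. \<V> \<subseteq> \<U> \<and> |\<V>| \<le>o \<kappa> \<and> Y \<subseteq> \<Union>\<V>))"
    (is "_ \<longleftrightarrow> ?R")
proof -
  \<comment> \<open>The absence of a free sequence of length kappa^+ is the middle term linking (a)
    and (b).\<close>
  have "(\<nexists>p. free_sequence X (cardSuc \<kappa>) p) \<longleftrightarrow> ?R"
  proof
    assume no: "\<nexists>p. free_sequence X (cardSuc \<kappa>) p"
    show ?R
    proof (intro allI impI, rule ccontr)
      fix Y \<U>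
      assume "Y \<subseteq> topspace X" "\<forall>U\<in>\<U>. openin X U \<and> U \<noteq> {}"
        "\<forall>A. A \<subseteq> Y \<longrightarrow> |A| \<le>o \<kappa> \<longrightarrow> (\<exists>U\<in>\<U>. X closure_of A \<subseteq> U)"
        "\<nexists>\<V>. \<V> \<subseteq> \<U> \<and> |\<V>| \<le>o \<kappa> \<and> Y \<subseteq> \<Union>\<V>"
      then have "\<exists>p. free_sequence X (cardSuc \<kappa>) p"
        by (intro free_sequence_of_no_small_cover[OF assms, of Y X \<U>]) auto
      then show False
        using no by blast
    qed
  next
    assume R: ?R
    show "\<nexists>p. free_sequence X (cardSuc \<kappa>) p"
    proof
      assume "\<exists>p. free_sequence X (cardSuc \<kappa>) p"
      then obtain p where p: "free_sequence X (cardSuc \<kappa>) p" ..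
      show False
        by (rule free_sequence_no_small_cover[OF assms p]) (use R in metis)
    qed
  qed
  moreover have "Card_order \<kappa>"
    using assms ..
  ultimately show ?thesis
    by (simp only: free_sequence_number_ordLeq_iff)
qed

end
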